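(* Let $p$ be a complex number with $p^2+4\neq 0$, and let $\{u_k\}$ and $\{v_k\}$ be the generalized Fibonacci and Lucas sequences with parameter $p$. Then for every integer $n\ge 0$ and every integer $r\ge 1$, $$\sum_{k=0}^{n}\binom{2n}{n+k}u_{k}^{2r}=\begin{cases}\displaystyle \frac{1}{(p^{2}+4)^{r}}\left(\binom{2r}{r}2^{2n-1}+\sum_{i=0}^{r-1}(-1)^{i(n+1)}\binom{2r}{i}v_{r-i}^{2n}\right) & \text{if } r \text{ is even},\\[3ex] \displaystyle (p^{2}+4)^{n-r}\left(\sum_{i=0}^{r-1}(-1)^{i(n+1)}\binom{2r}{i}u_{r-i}^{2n}\right) & \text{if } r \text{ is odd}.\end{cases}$$
   Context: For a complex number $p$, the sequences $\{u_k\}_{k\ge 0}$ and $\{v_k\}_{k\ge 0}$ of complex numbers are defined by $u_0=0$, $u_1=1$, $u_{k+1}=p\,u_k+u_{k-1}$ for $k\ge 1$, and $v_0=2$, $v_1=p$, $v_{k+1}=p\,v_k+v_{k-1}$ for $k\ge 1$.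
   Formalization: For odd r the identity is stated only for n ≥ 1, since at n = 0 it is false: the left side is 0 while the right side is nonzero (for r = 1 it is 1/(p²+4)); even r still covers all n ≥ 0. *)

theory Defs
  imports Complex_Main
begin

fun gfib :: "complex \<Rightarrow> nat \<Rightarrow> complex" where
  "gfib p 0 = 0"
| "gfib p (Suc 0) = 1"
| "gfib p (Suc (Suc k)) = p * gfib p (Suc k) + gfib p k"

fun gluc :: "complex \<Rightarrow> nat \<Rightarrow> complex" where
  "gluc p 0 = 2"
| "gluc p (Suc 0) = p"
| "gluc p (Suc (Suc k)) = p * gluc p (Suc k) + gluc p k"

(* The odd-r identity cannot hold at n = 0: the left-hand side is u_0^(2r) = 0, while the
   right-hand side is (p^2+4)^(-r) times the sum below, since every u_(r-i)^(2n) is then 1.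
   (For n \<ge> 1 the term i = r, which would complete the binomial sum, vanishes because u_0 = 0.) *)
lemma odd_case_fails_at_zero:
  fixes p :: complex and r :: nat
  assumes "p^2 + 4 \<noteq> 0" and "odd r"
  shows "(\<Sum>k=0..0. of_nat ((2 * 0) choose (0 + k)) * gfib p k ^ (2 * r))
    \<noteq> (p^2 + 4) powi (int 0 - int r) *
       (\<Sum>i<r. (-1) ^ (i * (0 + 1)) * of_nat ((2 * r) choose i) * gfib p (r - i) ^ (2 * 0))"
proof -
  obtain m where m: "r = Suc m" using \<open>odd r\<close> by (cases r) auto
  have "(\<Sum>i<r. (-1) ^ i * of_nat ((2 * r) choose i) :: complex)
      = (\<Sum>i\<le>m. (of_nat (2 * r) gchoose i) * (-1) ^ i)"
    unfolding m lessThan_Suc_atMost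
    by (intro sum.cong refl) (simp only: binomial_gbinomial mult.commute)
  also have "\<dots> = (-1) ^ m * ((of_nat (2 * r) - 1) gchoose m)"
    by (rule gbinomial_sum_lower_neg)
  also have "(of_nat (2 * r) - 1 :: complex) = of_nat (2 * m + 1)" by (simp add: m)
  also have "(of_nat (2 * m + 1) :: complex) gchoose m = of_nat ((2 * m + 1) choose m)"
    by (simp only: binomial_gbinomial)
  finally have "(\<Sum>i<r. (-1) ^ i * of_nat ((2 * r) choose i) :: complex) \<noteq> 0" by simp
  moreover have "(p^2 + 4) powi (- int r) \<noteq> 0" using assms(1) by simp
  moreover have "(0::complex) ^ (2 * r) = 0" using odd_pos[OF \<open>odd r\<close>] by simp
  ultimately show ?thesis by (simp add: zero_power)
qed

end

theory Submission
  imports Defs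
begin

text \<open>
  Let \<open>a\<close>, \<open>b\<close> be the roots of \<open>x^2 = p x + 1\<close>, so that \<open>a + b = p\<close>, \<open>a b = -1\<close> and
  \<open>(a - b)^2 = p^2 + 4\<close>. By the Binet formula, \<open>(p^2 + 4)^r u_k^(2r)\<close> is \<open>(a^k - b^k)^(2r)\<close>, and
  expanding this binomially gives a combination of the powers \<open>z_i^k\<close> with
  \<open>z_i = a^(2r-i) b^i\<close>, for \<open>i \<le> 2r\<close>. Since \<open>z_i z_(2r-i) = (a b)^(2r) = 1\<close>, pairing \<open>i\<close> with
  \<open>2r-i\<close> replaces \<open>z_i^k\<close> by the symmetric expression \<open>z_i^k + z_i^(-k)\<close>, and its sum over \<open>k\<close>
  against the upper half of the row \<open>2n\<close> of Pascal's triangle is essentially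
  \<open>z^(-n) (1 + z)^(2n) = (2 + z + 1/z)^n\<close> (lemma \<open>half_central_binomial_sum\<close>). The correction
  term, the central coefficient counted twice, cancels because the alternating sum of the row
  \<open>2r\<close> vanishes.

  What remains (lemma \<open>binet_power_sum\<close>) is a sum of terms
  \<open>(2 + (-1)^i (a^(2m) + b^(2m)))^n\<close> with \<open>m = r - i\<close>. The bracket is, up to the sign
  \<open>(-1)^i\<close>, a perfect square: as \<open>(a b)^m = (-1)^m\<close>, it is \<open>(a^m + b^m)^2 = v_m^2\<close> when \<open>i\<close> and
  \<open>m\<close> have the same parity, and \<open>(a^m - b^m)^2 = (p^2 + 4) u_m^2\<close> otherwise. This is the case
  distinction on the parity of \<open>r\<close>. The middle term \<open>i = r\<close> has base \<open>4\<close> or \<open>0\<close> accordingly; its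
  disappearance for odd \<open>r\<close> is what requires \<open>n \<ge> 1\<close>.
\<close>

section \<open>Folding binomial sums at the centre\<close>

lemma sum_atMost_even_fold:
  fixes h :: "nat \<Rightarrow> 'a::comm_monoid_add"
  shows "(\<Sum>j\<le>2*m. h j) = h m + (\<Sum>i<m. h i + h (2*m - i))"
proof -
  have "(\<Sum>j\<le>2*m. h j) = (\<Sum>j<m. h j) + (\<Sum>j\<in>{m..2*m}. h j)"
    by (subst sum.union_disjoint [symmetric]) (auto intro: sum.cong)
  also have "(\<Sum>j\<in>{m..2*m}. h j) = h m + (\<Sum>j\<in>{m<..2*m}. h j)"
    by (rule sum.head) simp
  also have "(\<Sum>j\<in>{m<..2*m}. h j) = (\<Sum>i<m. h (2*m - i))"
    by (rule sum.reindex_bij_witness [of _ "\<lambda>i. 2*m - i" "\<lambda>j. 2*m - j"]) auto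
  finally show ?thesis
    by (simp add: sum.distrib ac_simps)
qed

text \<open>
  With \<open>w = 1/z\<close>, the right-hand power is \<open>w^n (1 + z)^(2n)\<close>, a Laurent polynomial whose
  coefficients at \<open>z^k\<close> and \<open>w^k\<close> agree; folding it at its centre gives the left-hand side, except
  that there \<open>k = 0\<close> is counted twice.
\<close>

lemma half_central_binomial_sum:
  fixes z w :: "'a::comm_semiring_1"
  assumes zw: "z * w = 1"
  shows "(\<Sum>k\<le>n. of_nat ((2*n) choose (n + k)) * (z^k + w^k)) =
    (2 + z + w) ^ n + of_nat ((2*n) choose n)"
proof -
  define c where "c j = (of_nat ((2*n) choose j) :: 'a)" for j
  have cancel: "w^i * z^(i + j) = z^j" "w^(i + j) * z^i = w^j" for i j
  proof -
    have wz: "w^i * z^i = 1"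
      by (metis zw mult.commute power_mult_distrib power_one)
    show "w^i * z^(i + j) = z^j"
      using wz by (simp add: power_add flip: mult.assoc)
    show "w^(i + j) * z^i = w^j"
      using wz by (metis mult.commute mult.left_commute mult_1_right power_add)
  qed
  have "2 + z + w = w * (1 + z)^2"
    using zw by (simp add: power2_eq_square algebra_simps flip: one_add_one mult.assoc)
  then have "(2 + z + w)^n = w^n * (z + 1)^(2*n)"
    by (simp add: power_mult_distrib power_mult add.commute)
  also have "\<dots> = (\<Sum>j\<le>2*n. w^n * (c j * z^j))"
    by (simp add: binomial_ring c_def sum_distrib_left)
  also have "\<dots> = w^n * (c n * z^n) +
      (\<Sum>i<n. w^n * (c i * z^i) + w^n * (c (2*n - i) * z^(2*n - i)))"
    by (rule sum_atMost_even_fold)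
  also have "w^n * (c n * z^n) = c n"
    using cancel(1) [of n 0] by (simp add: ac_simps)
  also have "(\<Sum>i<n. w^n * (c i * z^i) + w^n * (c (2*n - i) * z^(2*n - i))) =
      (\<Sum>i<n. c (n + (n - i)) * (z^(n - i) + w^(n - i)))"
  proof (rule sum.cong [OF refl])
    fix i assume "i \<in> {..<n}"
    then have i: "i < n" by simp
    have ci: "c i = c (n + (n - i))"
      using i binomial_symmetric [of i "2*n"] by (simp add: c_def mult_2)
    have "w^n * z^i = w^(n - i)"
      using cancel(2) [of i "n - i"] i by simp
    moreover have "w^n * z^(2*n - i) = z^(n - i)"
      using cancel(1) [of n "n - i"] i by (simp add: mult_2)
    moreover have "c (2*n - i) = c (n + (n - i))"
      using i by (simp add: mult_2)
    ultimately show "w^n * (c i * z^i) + w^n * (c (2*n - i) * z^(2*n - i)) =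
        c (n + (n - i)) * (z^(n - i) + w^(n - i))"
      by (simp only: ci distrib_left mult.left_commute [of "w^n"] add.commute)
  qed
  finally have power_eq: "(2 + z + w)^n =
      c n + (\<Sum>i<n. c (n + (n - i)) * (z^(n - i) + w^(n - i)))" .
  have "(\<Sum>k\<le>n. c (n + k) * (z^k + w^k)) =
      (\<Sum>i\<le>n. c (n + (n - i)) * (z^(n - i) + w^(n - i)))"
    by (rule sum.reindex_bij_witness [of _ "\<lambda>i. n - i" "\<lambda>k. n - k"]) auto
  also have "\<dots> = (\<Sum>i<n. c (n + (n - i)) * (z^(n - i) + w^(n - i))) + (c n + c n)"
    by (simp add: distrib_left flip: lessThan_Suc_atMost)
  also have "\<dots> = (2 + z + w)^n + c n"
    by (simp only: power_eq) (simp only: ac_simps)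
  finally show ?thesis
    by (simp only: c_def)
qed

section \<open>Binet formulas\<close>

lemma root_power_recurrence:
  fixes a b :: "'a::comm_ring_1"
  assumes "a + b = p" "a * b = -1"
  shows "a^(Suc (Suc k)) = p * a^(Suc k) + a^k"
proof -
  have "a * a = p * a + 1"
    using assms by (auto simp: algebra_simps)
  then have "a * a * a^k = (p * a + 1) * a^k" by simp
  then show ?thesis
    by (simp add: algebra_simps)
qed

lemma binet_gfib:
  assumes "a + b = p" "a * b = -1"
  shows "(a - b) * gfib p k = a^k - b^k"
proof (induction k rule: induct_nat_012)
  case (ge2 k)
  have "(a - b) * gfib p (Suc (Suc k)) = p * ((a - b) * gfib p (Suc k)) + (a - b) * gfib p k"
    by (simp add: algebra_simps)
  also have "\<dots> = (p * a^(Suc k) + a^k) - (p * b^(Suc k) + b^k)"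
    by (simp only: ge2) (simp add: algebra_simps)
  also have "\<dots> = a^(Suc (Suc k)) - b^(Suc (Suc k))"
    using assms by (simp only: root_power_recurrence [of a b] root_power_recurrence [of b a]
      add.commute [of b] mult.commute [of b a])
  finally show ?case .
qed simp_all

lemma binet_gluc:
  assumes "a + b = p" "a * b = -1"
  shows "gluc p k = a^k + b^k"
proof (induction k rule: induct_nat_012)
  case (ge2 k)
  have "gluc p (Suc (Suc k)) = (p * a^(Suc k) + a^k) + (p * b^(Suc k) + b^k)"
    by (simp only: gluc.simps ge2) (simp add: algebra_simps)
  also have "\<dots> = a^(Suc (Suc k)) + b^(Suc (Suc k))"
    using assms by (simp only: root_power_recurrence [of a b] root_power_recurrence [of b a]
      add.commute [of b] mult.commute [of b a])
  finally show ?case .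
qed (use assms in simp_all)

section \<open>Power sums of Binet type\<close>

text \<open>
  Expanding \<open>(a^k - b^k)^(2r)\<close> produces the powers \<open>z_i^k\<close> with \<open>z_i = a^(2r-i) b^i\<close>. Writing this
  expansion once as it is and once with \<open>i\<close> replaced by \<open>2r-i\<close> accounts for the factor \<open>2\<close>, and
  puts the mutually inverse numbers \<open>z_i\<close> and \<open>z_(2r-i)\<close> side by side, so that the sum over \<open>k\<close>
  can be evaluated in closed form. The result is then folded at its middle term \<open>i = r\<close>; for
  \<open>i \<le> r\<close> extracting \<open>(a b)^i\<close> gives \<open>z_i = (-1)^i a^(2(r-i))\<close> and
  \<open>z_(2r-i) = (-1)^i b^(2(r-i))\<close>.
\<close>

lemma binet_power_sum:
  fixes a b :: "'a::comm_ring_1"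
  assumes ab: "a * b = -1" and r: "r \<ge> 1"
  shows "2 * (\<Sum>k\<le>n. of_nat ((2*n) choose (n + k)) * (a^k - b^k)^(2*r)) =
    (-1)^r * of_nat ((2*r) choose r) * (2 + 2 * (-1)^r)^n +
    2 * (\<Sum>i<r. (-1)^i * of_nat ((2*r) choose i) *
                 (2 + (-1)^i * (a^(2*(r - i)) + b^(2*(r - i))))^n)"
proof -
  define z where "z i = a^(2*r - i) * b^i" for i
  define e where "e i = ((-1)^i * of_nat ((2*r) choose i) :: 'a)" for i
  define C where "C k = (of_nat ((2*n) choose (n + k)) :: 'a)" for k
  have e_sym: "e (2*r - i) = e i" if "i \<le> 2*r" for i
    using that binomial_symmetric [of i "2*r"]
    by (simp add: e_def minus_one_power_iff)
  have z_inv: "z i * z (2*r - i) = 1" if "i \<le> 2*r" for i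
  proof -
    have "z i * z (2*r - i) = (a^(2*r - i) * a^i) * (b^i * b^(2*r - i))"
      using that by (simp add: z_def ac_simps)
    also have "\<dots> = (a * b)^(2*r)"
      using that by (simp add: power_mult_distrib flip: power_add)
    finally show ?thesis by (simp add: ab)
  qed
  have z_left: "z i = (-1)^i * a^(2*(r - i))" if "i \<le> r" for i
  proof -
    have "2*r - i = i + 2*(r - i)" using that by simp
    then have "z i = (a * b)^i * a^(2*(r - i))"
      by (simp only: z_def power_add power_mult_distrib ac_simps)
    then show ?thesis by (simp add: ab)
  qed
  have z_right: "z (2*r - i) = (-1)^i * b^(2*(r - i))" if "i \<le> r" for i
  proof -
    have "2*r - (2*r - i) = i" "2*r - i = i + 2*(r - i)" using that by simp_all
    then have "z (2*r - i) = (a * b)^i * b^(2*(r - i))"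
      by (simp only: z_def power_add power_mult_distrib ac_simps)
    then show ?thesis by (simp add: ab)
  qed
  \<comment> \<open>This disposes of the doubly counted central coefficient, and is where \<open>r \<ge> 1\<close> enters.\<close>
  have alternating: "(\<Sum>i\<le>2*r. e i) = 0"
  proof -
    have "(\<Sum>i\<le>2*r. e i) = (-1 + 1)^(2*r)"
      by (simp only: binomial_ring e_def power_one mult_1_left mult_1_right mult.commute)
    then show ?thesis using r by (simp add: zero_power)
  qed
  have expand: "(a^k - b^k)^(2*r) = (\<Sum>i\<le>2*r. e i * z i ^ k)" for k
  proof -
    have "(a^k - b^k)^(2*r) = (- (b^k) + a^k)^(2*r)" by simp
    also have "\<dots> = (\<Sum>i\<le>2*r. of_nat ((2*r) choose i) * (- (b^k))^i * (a^k)^(2*r - i))"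
      by (rule binomial_ring)
    also have "\<dots> = (\<Sum>i\<le>2*r. e i * z i ^ k)"
    proof (rule sum.cong [OF refl])
      fix i
      have "(- (b^k))^i = (-1)^i * (b^i)^k"
        by (subst power_minus) (simp add: power_mult [symmetric] mult.commute)
      moreover have "(a^k)^(2*r - i) = (a^(2*r - i))^k"
        by (simp add: power_mult [symmetric] mult.commute)
      ultimately show "of_nat ((2*r) choose i) * (- (b^k))^i * (a^k)^(2*r - i) = e i * z i ^ k"
        by (simp add: e_def z_def power_mult_distrib ac_simps)
    qed
    finally show ?thesis .
  qed
  have expand_rev: "(a^k - b^k)^(2*r) = (\<Sum>i\<le>2*r. e i * z (2*r - i) ^ k)" for k
    unfolding expand
    by (rule sum.reindex_bij_witness [of _ "\<lambda>i. 2*r - i" "\<lambda>i. 2*r - i"]) (auto simp: e_sym)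
  have "2 * (\<Sum>k\<le>n. C k * (a^k - b^k)^(2*r)) =
      (\<Sum>k\<le>n. C k * ((a^k - b^k)^(2*r) + (a^k - b^k)^(2*r)))"
    by (simp add: sum_distrib_left mult.left_commute flip: mult_2)
  also have "\<dots> = (\<Sum>k\<le>n. C k * ((\<Sum>i\<le>2*r. e i * z i ^ k) + (\<Sum>i\<le>2*r. e i * z (2*r - i) ^ k)))"
    by (simp only: expand [symmetric] expand_rev [symmetric])
  also have "\<dots> = (\<Sum>k\<le>n. \<Sum>i\<le>2*r. e i * (C k * (z i ^ k + z (2*r - i) ^ k)))"
    by (simp add: sum_distrib_left distrib_left mult.left_commute flip: sum.distrib)
  also have "\<dots> = (\<Sum>i\<le>2*r. e i * (\<Sum>k\<le>n. C k * (z i ^ k + z (2*r - i) ^ k)))"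
    by (subst sum.swap) (simp add: sum_distrib_left)
  also have "\<dots> = (\<Sum>i\<le>2*r. e i * ((2 + z i + z (2*r - i))^n + of_nat ((2*n) choose n)))"
    unfolding C_def by (intro sum.cong refl) (simp add: half_central_binomial_sum z_inv)
  also have "\<dots> = (\<Sum>i\<le>2*r. e i * (2 + z i + z (2*r - i))^n)"
    by (simp add: distrib_left sum.distrib alternating flip: sum_distrib_right)
  also have "\<dots> = e r * (2 + z r + z (2*r - r))^n +
      (\<Sum>i<r. e i * (2 + z i + z (2*r - i))^n +
             e (2*r - i) * (2 + z (2*r - i) + z (2*r - (2*r - i)))^n)"
    by (rule sum_atMost_even_fold)
  also have "\<dots> = e r * (2 + z r + z (2*r - r))^n +
      2 * (\<Sum>i<r. e i * (2 + z i + z (2*r - i))^n)"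
  proof -
    have "e i * (2 + z i + z (2*r - i))^n +
          e (2*r - i) * (2 + z (2*r - i) + z (2*r - (2*r - i)))^n =
        e i * (2 + z i + z (2*r - i))^n + e i * (2 + z i + z (2*r - i))^n" if "i < r" for i
      using that by (simp add: e_sym) (simp add: ac_simps)
    then show ?thesis
      by (subst sum_distrib_left)
        (intro arg_cong2 [of _ _ _ _ "(+)"] sum.cong refl,
         simp only: lessThan_iff mult_2 [of "e x * y" for x y])
  qed
  also have "\<dots> = e r * (2 + 2 * (-1)^r)^n +
      2 * (\<Sum>i<r. e i * (2 + (-1)^i * (a^(2*(r - i)) + b^(2*(r - i))))^n)"
  proof -
    have "z r = (-1)^r" "2*r - r = r"
      using z_left [of r] by simp_all
    then have middle: "2 + z r + z (2*r - r) = 2 + 2 * (-1)^r"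
      by (simp only: add.assoc mult_2 [of "(-1)^r"])
    have outer: "2 + z i + z (2*r - i) = 2 + (-1)^i * (a^(2*(r - i)) + b^(2*(r - i)))"
      if "i < r" for i
      using that by (simp only: z_left z_right less_imp_le distrib_left add.assoc)
    show ?thesis
      unfolding middle
      by (rule arg_cong [of _ _ "\<lambda>s. e r * (2 + 2 * (-1)^r)^n + 2 * s"], rule sum.cong [OF refl])
        (simp only: lessThan_iff outer)
  qed
  finally show ?thesis
    by (simp add: e_def C_def)
qed

section \<open>Even power sums of generalized Fibonacci numbers\<close>

theorem theorem3p1:
  fixes p :: complex and n r :: nat
  assumes "p^2 + 4 \<noteq> 0"
    and "r \<ge> 1"
    and "odd r \<Longrightarrow> n \<ge> 1"
  shows "(\<Sum>k=0..n. of_nat ((2 * n) choose (n + k)) * gfib p k ^ (2 * r)) =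
    (if even r then
       1 / (p^2 + 4) ^ r *
         (of_nat ((2 * r) choose r) * 2 powi (2 * int n - 1) +
          (\<Sum>i<r. (-1) ^ (i * (n + 1)) * of_nat ((2 * r) choose i) * gluc p (r - i) ^ (2 * n)))
     else
       (p^2 + 4) powi (int n - int r) *
         (\<Sum>i<r. (-1) ^ (i * (n + 1)) * of_nat ((2 * r) choose i) * gfib p (r - i) ^ (2 * n)))"
proof -
  define D where "D = p^2 + 4"
  define a where "a = (p + csqrt D) / 2"
  define b where "b = (p - csqrt D) / 2"
  have sum_ab: "a + b = p"
    by (simp add: a_def b_def field_simps)
  have prod_ab: "a * b = -1"
  proof -
    have "a * b = (p^2 - (csqrt D)^2) / 4"
      by (simp add: a_def b_def power2_eq_square field_simps)
    then show ?thesis by (simp add: D_def)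
  qed
  have discr: "(a - b)^2 = D"
    by (simp add: a_def b_def flip: diff_divide_distrib)
  have D: "D \<noteq> 0" using assms(1) by (simp add: D_def)
  note u = binet_gfib [OF sum_ab prod_ab] and v = binet_gluc [OF sum_ab prod_ab]
  have ab_pow: "a^m * b^m = (-1)^m" for m
    by (simp add: prod_ab flip: power_mult_distrib)
  define S where "S = (\<Sum>k=0..n. of_nat ((2*n) choose (n + k)) * gfib p k ^ (2*r))"
  have u_pow: "(a^k - b^k)^(2*m) = D^m * gfib p k ^ (2*m)" for k m
    by (simp only: u [symmetric] power_mult_distrib power_mult discr)
  have "D^r * S = (\<Sum>k\<le>n. of_nat ((2*n) choose (n + k)) * (a^k - b^k)^(2*r))"
    by (simp add: S_def u_pow sum_distrib_left mult.left_commute atLeast0AtMost)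
  then have key: "2 * (D^r * S) =
      (-1)^r * of_nat ((2*r) choose r) * (2 + 2 * (-1)^r)^n +
      2 * (\<Sum>i<r. (-1)^i * of_nat ((2*r) choose i) *
                   (2 + (-1)^i * (a^(2*(r - i)) + b^(2*(r - i))))^n)"
    using binet_power_sum [OF prod_ab assms(2)] by simp
  have sign: "(-1)^i * x * ((-1)^i * y)^n = (-1)^(i * (n + 1)) * x * y^n" for i and x y :: complex
    by (simp add: power_mult_distrib power_add power_mult)
  show ?thesis
  proof (cases "even r")
    case True
    \<comment> \<open>Here \<open>(a b)^(r-i) = (-1)^i\<close>, so the cross term of \<open>v_(r-i)^2\<close> is the missing \<open>2 (-1)^i\<close>.\<close>
    have square: "2 + (-1)^i * (a^(2*(r - i)) + b^(2*(r - i))) = (-1)^i * gluc p (r - i)^2"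
      if "i < r" for i
    proof -
      have "(-1)^(r - i) = ((-1)^i :: complex)"
        using True that by (simp add: minus_one_power_iff)
      then have "gluc p (r - i)^2 = a^(2*(r - i)) + b^(2*(r - i)) + 2 * (-1)^i"
        by (simp add: v power2_sum power_even_eq ab_pow mult.assoc)
      then show ?thesis by (simp add: distrib_left flip: power_mult_distrib mult.left_commute)
    qed
    have "(\<Sum>i<r. (-1)^i * of_nat ((2*r) choose i) *
            (2 + (-1)^i * (a^(2*(r - i)) + b^(2*(r - i))))^n) =
        (\<Sum>i<r. (-1) ^ (i * (n + 1)) * of_nat ((2 * r) choose i) * gluc p (r - i) ^ (2 * n))"
      (is "_ = ?R")
      by (intro sum.cong refl) (simp only: lessThan_iff square sign, simp only: power_mult)
    then have "2 * (D^r * S) = of_nat ((2*r) choose r) * 4^n + 2 * ?R"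
      using key True by simp
    moreover have "(4::complex)^n = 2 * 2 powi (2 * int n - 1)"
    proof -
      have "(2::complex) powi (2 * int n - 1) = 2 powi (int (2 * n)) / 2"
        by (simp add: power_int_diff)
      also have "\<dots> = 4^n / 2"
        by (simp only: power_int_of_nat power_mult) simp
      finally show ?thesis by (simp only:) simp
    qed
    ultimately have "2 * (D^r * S) = 2 * (of_nat ((2*r) choose r) * 2 powi (2 * int n - 1) + ?R)"
      by (simp only: distrib_left mult.left_commute)
    then have "D^r * S = of_nat ((2*r) choose r) * 2 powi (2 * int n - 1) + ?R"
      by (simp only: mult_cancel_left) simp
    then show ?thesis
      using True D unfolding S_def [symmetric] D_def [symmetric]
      by (simp add: field_simps)
  next
    case False
    \<comment> \<open>Now \<open>(a b)^(r-i) = -(-1)^i\<close>, and the minus sign turns the square of the sum into that of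
      the difference.\<close>
    have square: "2 + (-1)^i * (a^(2*(r - i)) + b^(2*(r - i))) = (-1)^i * (D * gfib p (r - i)^2)"
      if "i < r" for i
    proof -
      have "(-1)^(r - i) = (- ((-1)^i) :: complex)"
        using False that by (simp add: minus_one_power_iff)
      then have "(a^(r - i) - b^(r - i))^2 = a^(2*(r - i)) + b^(2*(r - i)) + 2 * (-1)^i"
        by (simp add: power2_diff power_even_eq ab_pow mult.assoc)
      then have "D * gfib p (r - i)^2 = a^(2*(r - i)) + b^(2*(r - i)) + 2 * (-1)^i"
        using u_pow [of "r - i" 1] by simp
      then show ?thesis by (simp add: distrib_left flip: power_mult_distrib mult.left_commute)
    qed
    let ?R = "\<Sum>i<r. (-1) ^ (i * (n + 1)) * of_nat ((2 * r) choose i) * gfib p (r - i) ^ (2 * n)"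
    have "(\<Sum>i<r. (-1)^i * of_nat ((2*r) choose i) *
            (2 + (-1)^i * (a^(2*(r - i)) + b^(2*(r - i))))^n) =
        (\<Sum>i<r. D^n * ((-1) ^ (i * (n + 1)) * of_nat ((2 * r) choose i) * gfib p (r - i) ^ (2 * n)))"
      by (intro sum.cong refl)
        (simp only: lessThan_iff square sign, simp only: power_mult power_mult_distrib, simp only: ac_simps)
    also have "\<dots> = D^n * ?R"
      by (simp only: sum_distrib_left)
    \<comment> \<open>The middle term \<open>0^n\<close> vanishes because \<open>n \<ge> 1\<close> for odd \<open>r\<close>.\<close>
    finally have "2 * (D^r * S) = 2 * (D^n * ?R)"
      using key False assms(3) by (simp add: zero_power)
    then have "D^r * S = D^n * ?R" by simp
    then have "S = D powi (int n - int r) * ?R"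
      using D by (simp add: power_int_diff field_simps)
    then show ?thesis
      using False unfolding S_def D_def by simp
  qed
qed

end
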